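(* Let $n\ge 1$, let $\theta\in\mathbb{R}$ with $\theta\neq 0$, let $A_n\in\mathbb{C}^{n\times n}$, and let $$\mathcal{M}=\begin{bmatrix}\theta I_n & A_n^*\\ A_n & -\theta I_n\end{bmatrix}\in\mathbb{C}^{2n\times 2n},\qquad |\mathcal{M}|:=\sqrt{\mathcal{M}^2}.$$ Then $|\mathcal{M}|^{-1}\mathcal{M}$ is both Hermitian and unitary. In other words, $|\mathcal{M}|^{-1}\mathcal{M}$ has only two distinct eigenvalues, $1$ and $-1$.
   Context: $I_n$ is the $n\times n$ identity matrix and $A_n^*$ is the conjugate transpose of $A_n$. For a Hermitian positive semidefinite matrix $H=Q^*\mathrm{diag}(\lambda_1,\dots,\lambda_m)Q$ with $Q$ unitary, $\sqrt{H}:=Q^*\mathrm{diag}(\sqrt{\lambda_1},\dots,\sqrt{\lambda_m})Q$ is its positive semidefinite square root. *)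

theory Defs
  imports Complex_Main
    "Jordan_Normal_Form.Matrix"
    "Jordan_Normal_Form.Char_Poly"
    "Jordan_Normal_Form.Gauss_Jordan_Elimination"
    "Jordan_Normal_Form.Schur_Decomposition"
begin

definition hermitian_mat :: "complex mat \<Rightarrow> bool" where
  "hermitian_mat A \<longleftrightarrow> square_mat A \<and> mat_adjoint A = A"

definition unitary_mat :: "complex mat \<Rightarrow> bool" where
  "unitary_mat A \<longleftrightarrow>
     square_mat A \<and> mat_adjoint A * A = 1\<^sub>m (dim_row A) \<and> A * mat_adjoint A = 1\<^sub>m (dim_row A)"

text \<open>The square root is read off from a unitary diagonalization. The description
  is meaningful for Hermitian positive semidefinite \<open>H\<close> only: there a diagonalization exists
  and the resulting matrix does not depend on the one that is chosen.\<close>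

definition psd_sqrt :: "complex mat \<Rightarrow> complex mat" where
  "psd_sqrt H = (THE S. \<exists>Q (l :: nat \<Rightarrow> real).
     Q \<in> carrier_mat (dim_row H) (dim_row H) \<and> unitary_mat Q \<and>
     (\<forall>i < dim_row H. l i \<ge> 0) \<and>
     H = mat_adjoint Q * mat_diag (dim_row H) (\<lambda>i. complex_of_real (l i)) * Q \<and>
     S = mat_adjoint Q * mat_diag (dim_row H) (\<lambda>i. complex_of_real (sqrt (l i))) * Q)"

definition mat_abs :: "complex mat \<Rightarrow> complex mat" where
  "mat_abs M = psd_sqrt (M ^\<^sub>m 2)"

text \<open>\<open>mat_inverse\<close> is option-valued, so \<open>mat_inv\<close> is unspecified on singular matrices;
  statements that use it should also assert invertibility.\<close>

definition mat_inv :: "complex mat \<Rightarrow> complex mat" where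
  "mat_inv A = the (mat_inverse A)"

end

theory Submission
  imports Defs
begin

text \<open>
  The matrix \<open>M\<close> is Hermitian, so the spectral theorem gives a unitary \<open>Q\<close> and real \<open>d i\<close> with
  \<open>M = Q* diag(d) Q\<close>. Everything then happens on the diagonal: \<open>M\<^sup>2\<close> is \<open>Q* diag(d\<^sup>2) Q\<close>, its
  root \<open>mat_abs M\<close> is \<open>Q* diag(\<bar>d\<bar>) Q\<close>, and the matrix in question is \<open>Q* diag(sgn d) Q\<close>.
  Once all \<open>d i\<close> are nonzero, each sign is \<open>1\<close> or \<open>-1\<close>; such a matrix is Hermitian and
  squares to the identity, hence is unitary, and its eigenvalues are the signs that occur.

  Two facts use the block structure of \<open>M\<close>. Put \<open>J = diag(I, -I)\<close>. The off-diagonal blocks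
  anticommute with \<open>J\<close>, so \<open>M J + J M = 2 \<theta> I\<close>. In the eigenbasis of \<open>M\<close>, with
  \<open>B = Q J Q*\<close>, the diagonal entries of this identity read \<open>2 d i B i i = 2 \<theta>\<close>, and so no
  \<open>d i\<close> vanishes. Both signs occur because the diagonal of \<open>M\<close> contains \<open>\<theta>\<close> as well as
  \<open>-\<theta>\<close>, and each diagonal entry is a combination of the \<open>d i\<close> with nonnegative weights.

  Three general results carry the argument: the spectral theorem
  (\<open>hermitian_spectral_decomposition\<close>), the fact that a function of a matrix
  does not depend on the diagonalization through which it is computed (\<open>spectral_mat_map\<close>, which
  makes the square root well defined), and the resulting formula for the polar factor
  (\<open>polar_factor_spectral_mat\<close>).
\<close>

section \<open>Adjoints and unitary matrices\<close>

lemma adjoint_carrier [simp]: "A \<in> carrier_mat m n \<Longrightarrow> mat_adjoint A \<in> carrier_mat n m"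
  unfolding mat_adjoint_def by auto

lemma adjoint_index [simp]:
  fixes A :: "complex mat"
  shows "i < dim_col A \<Longrightarrow> j < dim_row A \<Longrightarrow> mat_adjoint A $$ (i, j) = cnj (A $$ (j, i))"
  unfolding mat_adjoint_def by (simp add: mat_of_rows_def)

lemma adjoint_dim [simp]:
  "dim_row (mat_adjoint A) = dim_col A" "dim_col (mat_adjoint A) = dim_row A"
  unfolding mat_adjoint_def by auto

lemma adjoint_adjoint [simp]: "mat_adjoint (mat_adjoint A) = (A :: complex mat)"
  by (rule eq_matI) auto

lemma adjoint_mult:
  fixes A B :: "complex mat"
  assumes "A \<in> carrier_mat m n" "B \<in> carrier_mat n k"
  shows "mat_adjoint (A * B) = mat_adjoint B * mat_adjoint A"
  using assms by (intro eq_matI) (auto simp: scalar_prod_def mult.commute)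

lemma adjoint_mat_diag: "mat_adjoint (mat_diag n f) = mat_diag n (\<lambda>i. cnj (f i))"
  by (rule eq_matI) (auto simp: mat_diag_def)

lemma adjoint_four_block:
  fixes A B C D :: "complex mat"
  assumes "A \<in> carrier_mat n n" "B \<in> carrier_mat n m" "C \<in> carrier_mat m n" "D \<in> carrier_mat m m"
  shows "mat_adjoint (four_block_mat A B C D) =
    four_block_mat (mat_adjoint A) (mat_adjoint C) (mat_adjoint B) (mat_adjoint D)"
  using assms by (intro eq_matI) auto

lemma mult_block_diag:
  assumes "A \<in> carrier_mat n n" "A' \<in> carrier_mat n n" "D \<in> carrier_mat m m" "D' \<in> carrier_mat m m"
  shows "four_block_mat A (0\<^sub>m n m) (0\<^sub>m m n) D * four_block_mat A' (0\<^sub>m n m) (0\<^sub>m m n) D' =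
    four_block_mat (A * A') (0\<^sub>m n m) (0\<^sub>m m n) (D * D')"
  using assms by (subst mult_four_block_mat[of _ n n _ m _ m _ _ n _ m]) auto

lemma unitary_matD:
  assumes "unitary_mat Q" "Q \<in> carrier_mat n n"
  shows "mat_adjoint Q * Q = 1\<^sub>m n" "Q * mat_adjoint Q = 1\<^sub>m n"
  using assms unfolding unitary_mat_def by auto

lemma unitary_matI:
  assumes "Q \<in> carrier_mat n n" "mat_adjoint Q * Q = 1\<^sub>m n"
  shows "unitary_mat Q"
  using assms mat_mult_left_right_inverse[of "mat_adjoint Q" n Q] unfolding unitary_mat_def by auto

lemma unitary_adjoint: "unitary_mat Q \<Longrightarrow> unitary_mat (mat_adjoint Q)"
  unfolding unitary_mat_def by auto

text \<open>For square matrices of one fixed size, the side conditions of associativity and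
  cancellation mention a single dimension; with that dimension instantiated, the simplifier
  can normalize products to right-nested form and cancel inverse pairs inside them.\<close>

lemma square_mult_carrier:
  "A \<in> carrier_mat n n \<Longrightarrow> B \<in> carrier_mat n n \<Longrightarrow> A * B \<in> carrier_mat n n"
  by (rule mult_carrier_mat)

lemma square_mult_assoc:
  "A \<in> carrier_mat n n \<Longrightarrow> B \<in> carrier_mat n n \<Longrightarrow> C \<in> carrier_mat n n \<Longrightarrow> A * B * C = A * (B * C)"
  by (rule assoc_mult_mat)

lemma mult_cancel_mid:
  fixes P :: "complex mat"
  assumes "P \<in> carrier_mat n n" "R \<in> carrier_mat n n" "P * R = 1\<^sub>m n" "X \<in> carrier_mat n n"
  shows "P * (R * X) = X"
  using assms by (simp flip: assoc_mult_mat[of P n n R n X n])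

lemma unitary_mult:
  assumes P: "P \<in> carrier_mat n n" "unitary_mat P" and Q: "Q \<in> carrier_mat n n" "unitary_mat Q"
  shows "unitary_mat (P * Q)"
proof (rule unitary_matI)
  show "mat_adjoint (P * Q) * (P * Q) = 1\<^sub>m n"
    using assms unitary_matD[of P n] unitary_matD[of Q n]
    by (simp add: adjoint_mult[of _ n n _ n] square_mult_assoc[where n = n] square_mult_carrier[where n = n]
        mult_cancel_mid[of "mat_adjoint P" n P])
qed (use assms in auto)

section \<open>Functional calculus through a unitary diagonalization\<close>

text \<open>If \<open>Q\<close> is unitary, the rows of \<open>Q\<close> are the conjugates of an orthonormal eigenbasis, and
  the eigenvalues are the values \<open>f i\<close> for \<open>i < n\<close>. The adjoint stands on the left
  so that the shape agrees with the one in \<open>psd_sqrt\<close>.\<close>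

definition spectral_mat :: "nat \<Rightarrow> complex mat \<Rightarrow> (nat \<Rightarrow> complex) \<Rightarrow> complex mat" where
  "spectral_mat n Q f = mat_adjoint Q * mat_diag n f * Q"

lemma spectral_mat_carrier [simp]:
  "Q \<in> carrier_mat n n \<Longrightarrow> spectral_mat n Q f \<in> carrier_mat n n"
  unfolding spectral_mat_def by (auto simp: mat_diag_def)

lemma spectral_mat_cong:
  assumes "\<And>i. i < n \<Longrightarrow> f i = g i"
  shows "spectral_mat n Q f = spectral_mat n Q g"
proof -
  have "mat_diag n f = mat_diag n g" using assms by (auto simp: mat_diag_def)
  thus ?thesis by (simp add: spectral_mat_def)
qed

lemma spectral_mat_one:
  "unitary_mat Q \<Longrightarrow> Q \<in> carrier_mat n n \<Longrightarrow> spectral_mat n Q (\<lambda>_. 1) = 1\<^sub>m n"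
  unfolding spectral_mat_def by (simp add: unitary_matD)

lemma spectral_mat_mult:
  assumes "unitary_mat Q" and Q [simp]: "Q \<in> carrier_mat n n"
  shows "spectral_mat n Q f * spectral_mat n Q g = spectral_mat n Q (\<lambda>i. f i * g i)"
  using unitary_matD[OF assms]
  by (simp add: spectral_mat_def square_mult_assoc[where n = n] square_mult_carrier[where n = n]
        mult_cancel_mid[of Q n "mat_adjoint Q"]
       flip: assoc_mult_mat[of "mat_diag n f" n n "mat_diag n g" n Q n])

lemma adjoint_spectral_mat:
  assumes [simp]: "Q \<in> carrier_mat n n"
  shows "mat_adjoint (spectral_mat n Q f) = spectral_mat n Q (\<lambda>i. cnj (f i))"
  by (simp add: spectral_mat_def adjoint_mult[of _ n n _ n] adjoint_mat_diag
      square_mult_assoc[where n = n] square_mult_carrier[where n = n])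

lemma spectral_mat_unitary_change:
  assumes [simp]: "Q \<in> carrier_mat n n" "W \<in> carrier_mat n n"
  shows "mat_adjoint W * spectral_mat n Q f * W = spectral_mat n (Q * W) f"
  by (simp add: spectral_mat_def adjoint_mult[of _ n n _ n]
      square_mult_assoc[where n = n] square_mult_carrier[where n = n])

text \<open>A diagonal entry of the matrix is a combination of the eigenvalues with nonnegative
  weights. A bound on the signs of all eigenvalues therefore passes to the diagonal.\<close>

lemma spectral_mat_diag_entry:
  assumes "Q \<in> carrier_mat n n" "a < n"
  shows "spectral_mat n Q f $$ (a, a) = (\<Sum>i<n. f i * of_real ((cmod (Q $$ (i, a)))\<^sup>2))"
proof -
  have "spectral_mat n Q f $$ (a, a) = (\<Sum>i<n. f i * (cnj (Q $$ (i, a)) * Q $$ (i, a)))"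
    using assms
    by (auto simp: spectral_mat_def mat_diag_mult_right[of _ n n] scalar_prod_def atLeast0LessThan
        intro!: sum.cong)
  thus ?thesis by (simp add: complex_norm_square mult.commute flip: of_real_power)
qed

text \<open>The matrix is similar to its diagonal factor, and a diagonal matrix has the characteristic
  polynomial whose roots are its diagonal entries.\<close>

lemma eigenvalue_spectral_mat:
  assumes "unitary_mat Q" and Q: "Q \<in> carrier_mat n n"
  shows "{k. eigenvalue (spectral_mat n Q f) k} = f ` {..<n}"
proof -
  have "similar_mat (spectral_mat n Q f) (mat_diag n f)"
    using unitary_matD[OF assms] Q
    by (intro similar_matI[of _ _ "mat_adjoint Q" Q n]) (auto simp: spectral_mat_def)
  hence "char_poly (spectral_mat n Q f) = char_poly (mat_diag n f)"
    by (rule char_poly_similar)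
  also have "\<dots> = (\<Prod>a\<leftarrow>diag_mat (mat_diag n f). [:- a, 1:])"
    by (rule char_poly_upper_triangular[of _ n]) (auto simp: mat_diag_def)
  also have "diag_mat (mat_diag n f) = map f [0..<n]"
    by (auto simp: diag_mat_def mat_diag_def)
  finally have "poly (char_poly (spectral_mat n Q f)) k = (\<Prod>a\<leftarrow>map f [0..<n]. k - a)" for k
    by (simp add: poly_prod_list o_def)
  thus ?thesis
    using eigenvalue_root_char_poly[OF spectral_mat_carrier[OF Q], of f]
    by auto
qed

lemma mat_inv_eqI:
  assumes A: "A \<in> carrier_mat n n" and B: "B \<in> carrier_mat n n" and AB: "A * B = 1\<^sub>m n"
  shows "invertible_mat A" "mat_inv A = B"
proof -
  have BA: "B * A = 1\<^sub>m n" using mat_mult_left_right_inverse[OF A B AB] .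
  show "invertible_mat A"
    using A B AB BA unfolding invertible_mat_def inverts_mat_def by auto
  have "A \<in> Units (ring_mat TYPE(complex) n ())"
    using A B AB BA unfolding Units_def ring_mat_def by auto
  then obtain C where C: "mat_inverse A = Some C"
    using mat_inverse(1)[OF A, of "()"] by (cases "mat_inverse A") auto
  have CA: "C * A = 1\<^sub>m n" "C \<in> carrier_mat n n" using mat_inverse(2)[OF A C] by auto
  have "C = C * (A * B)" using AB CA by simp
  also have "\<dots> = B" using mult_cancel_mid[OF CA(2) A CA(1) B] .
  finally show "mat_inv A = B" by (simp add: mat_inv_def C)
qed

text \<open>With \<open>U = Q P*\<close>, equality of the two matrices says \<open>U diag(f) = diag(g) U\<close>. Entrywise,
  \<open>U i j\<close> can be nonzero only where \<open>f j = g i\<close>, and this survives the application of any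
  function \<open>h\<close> to both sides.\<close>

lemma spectral_mat_map:
  assumes P: "unitary_mat P" "P \<in> carrier_mat n n" and Q: "unitary_mat Q" "Q \<in> carrier_mat n n"
    and eq: "spectral_mat n P f = spectral_mat n Q g"
  shows "spectral_mat n P (\<lambda>i. h (f i)) = spectral_mat n Q (\<lambda>i. h (g i))"
proof -
  note [simp] = P(2) Q(2) right_mult_one_mat[of _ n n]
    square_mult_assoc[where n = n] square_mult_carrier[where n = n] unitary_matD[OF P] unitary_matD[OF Q]
    mult_cancel_mid[OF _ _ unitary_matD(1)[OF P]] mult_cancel_mid[OF _ _ unitary_matD(1)[OF Q]]
    mult_cancel_mid[OF _ _ unitary_matD(2)[OF P]] mult_cancel_mid[OF _ _ unitary_matD(2)[OF Q]]
  define U where "U = Q * mat_adjoint P"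
  have U: "U \<in> carrier_mat n n" by (simp add: U_def)
  have "Q * spectral_mat n P f * mat_adjoint P = Q * spectral_mat n Q g * mat_adjoint P"
    by (simp only: eq)
  hence "U * mat_diag n f = mat_diag n g * U"
    by (simp add: spectral_mat_def U_def)
  hence entry: "U $$ (i, j) * f j = g i * U $$ (i, j)" if "i < n" "j < n" for i j
    using U that unfolding mat_diag_mult_left[OF U] mat_diag_mult_right[OF U]
    by (auto dest!: arg_cong[where f = "\<lambda>X. X $$ (i, j)"])
  have "U $$ (i, j) * h (f j) = h (g i) * U $$ (i, j)" if "i < n" "j < n" for i j
    using entry[OF that] by (cases "U $$ (i, j) = 0") auto
  hence "U * mat_diag n (\<lambda>i. h (f i)) = mat_diag n (\<lambda>i. h (g i)) * U"
    unfolding mat_diag_mult_left[OF U] mat_diag_mult_right[OF U] by (intro eq_matI) auto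
  hence "mat_adjoint Q * (U * mat_diag n (\<lambda>i. h (f i))) * P =
      mat_adjoint Q * (mat_diag n (\<lambda>i. h (g i)) * U) * P"
    by simp
  thus ?thesis by (simp add: spectral_mat_def U_def)
qed

section \<open>Square root, absolute value and polar factor\<close>

text \<open>Well-definedness of the description in \<open>psd_sqrt\<close>: existence is the given diagonalization,
  and uniqueness is \<open>spectral_mat_map\<close> for \<open>h = sqrt\<close>.\<close>

lemma psd_sqrt_spectral_mat:
  assumes Q: "unitary_mat Q" "Q \<in> carrier_mat n n" and l: "\<And>i. i < n \<Longrightarrow> 0 \<le> l i"
  shows "psd_sqrt (spectral_mat n Q (\<lambda>i. complex_of_real (l i))) =
    spectral_mat n Q (\<lambda>i. complex_of_real (sqrt (l i)))"
proof -
  define H where "H = spectral_mat n Q (\<lambda>i. complex_of_real (l i))"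
  have [simp]: "dim_row H = n" using Q(2) by (auto simp: H_def spectral_mat_def)
  \<comment> \<open>The function \<open>h\<close> acts on complex numbers, so the real root is taken of the real part.\<close>
  have unique: "S = spectral_mat n Q (\<lambda>i. complex_of_real (sqrt (l i)))"
    if "P \<in> carrier_mat n n" "unitary_mat P"
      and "H = spectral_mat n P (\<lambda>i. complex_of_real (m i))"
      and "S = spectral_mat n P (\<lambda>i. complex_of_real (sqrt (m i)))"
    for P and m :: "nat \<Rightarrow> real" and S
    using spectral_mat_map[OF that(2,1) Q, of "\<lambda>i. complex_of_real (m i)" "\<lambda>i. complex_of_real (l i)"
        "\<lambda>z. complex_of_real (sqrt (Re z))"] that(3,4)
    by (simp add: H_def)
  have "psd_sqrt H = spectral_mat n Q (\<lambda>i. complex_of_real (sqrt (l i)))"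
    unfolding psd_sqrt_def spectral_mat_def[symmetric] \<open>dim_row H = n\<close>
  proof (rule the_equality)
    show "\<exists>P m. P \<in> carrier_mat n n \<and> unitary_mat P \<and> (\<forall>i<n. 0 \<le> m i) \<and>
      H = spectral_mat n P (\<lambda>i. complex_of_real (m i)) \<and>
      spectral_mat n Q (\<lambda>i. complex_of_real (sqrt (l i))) =
        spectral_mat n P (\<lambda>i. complex_of_real (sqrt (m i)))"
      using Q l H_def by blast
  qed (use unique in blast)
  thus ?thesis by (simp add: H_def)
qed

lemma mat_abs_spectral_mat:
  assumes Q: "unitary_mat Q" "Q \<in> carrier_mat n n"
  shows "mat_abs (spectral_mat n Q (\<lambda>i. complex_of_real (d i))) =
    spectral_mat n Q (\<lambda>i. complex_of_real \<bar>d i\<bar>)"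
proof -
  have "spectral_mat n Q (\<lambda>i. complex_of_real (d i)) ^\<^sub>m 2 =
      spectral_mat n Q (\<lambda>i. complex_of_real ((d i)\<^sup>2))"
    using Q spectral_mat_carrier[OF Q(2), of "\<lambda>i. complex_of_real (d i)"]
    by (simp add: numeral_2_eq_2 spectral_mat_mult)
  thus ?thesis
    using psd_sqrt_spectral_mat[OF Q, of "\<lambda>i. (d i)\<^sup>2"] by (simp add: mat_abs_def)
qed

text \<open>The polar factor replaces each eigenvalue \<open>d i\<close> by \<open>d i / \<bar>d i\<bar>\<close>, its sign.\<close>

lemma polar_factor_spectral_mat:
  assumes Q: "unitary_mat Q" "Q \<in> carrier_mat n n" and d: "\<And>i. i < n \<Longrightarrow> d i \<noteq> 0"
    and M: "M = spectral_mat n Q (\<lambda>i. complex_of_real (d i))"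
  shows "invertible_mat (mat_abs M)"
    and "mat_inv (mat_abs M) * M = spectral_mat n Q (\<lambda>i. complex_of_real (sgn (d i)))"
proof -
  define B where "B = spectral_mat n Q (\<lambda>i. complex_of_real (inverse \<bar>d i\<bar>))"
  have abs: "mat_abs M = spectral_mat n Q (\<lambda>i. complex_of_real \<bar>d i\<bar>)"
    unfolding M by (rule mat_abs_spectral_mat[OF Q])
  have "mat_abs M * B = spectral_mat n Q (\<lambda>_. 1)"
    unfolding abs B_def spectral_mat_mult[OF Q] using d by (intro spectral_mat_cong) auto
  hence "mat_abs M * B = 1\<^sub>m n" using Q by (simp add: spectral_mat_one)
  moreover have "mat_abs M \<in> carrier_mat n n" "B \<in> carrier_mat n n"
    using Q by (auto simp: abs B_def)
  ultimately have inv: "mat_inv (mat_abs M) = B" and "invertible_mat (mat_abs M)"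
    using mat_inv_eqI by blast+
  thus "invertible_mat (mat_abs M)" by simp
  show "mat_inv (mat_abs M) * M = spectral_mat n Q (\<lambda>i. complex_of_real (sgn (d i)))"
    unfolding inv unfolding B_def M spectral_mat_mult[OF Q]
    using d by (intro spectral_mat_cong) (auto simp: sgn_real_def)
qed

section \<open>The spectral theorem for Hermitian matrices\<close>

text \<open>Complete \<open>v\<close> to a basis, orthogonalize it by Gram--Schmidt, which leaves the first vector
  untouched, and divide each vector by its norm.\<close>

lemma exists_unitary_first_column:
  fixes v :: "complex vec"
  assumes v: "v \<in> carrier_vec n" "v \<noteq> 0\<^sub>v n"
  obtains W c where "W \<in> carrier_mat n n" "unitary_mat W" "col W 0 = c \<cdot>\<^sub>v v"
proof -
  interpret cof_vec_space n "TYPE(complex)" .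
  define ws where "ws = gram_schmidt n (basis_completion v)"
  note b = basis_completion[OF v]
  note gs = gram_schmidt_result[OF b(2,4,5) refl, folded ws_def]
  have n: "n > 0" using v by (cases n) auto
  have ws: "set ws \<subseteq> carrier_vec n" "corthogonal ws" "length ws = n"
    using gs b by auto
  have hd: "hd ws = v"
    using gram_schmidt_hd[OF v(1), of "tl (basis_completion v)"] b(6,7) n
    by (cases "basis_completion v") (auto simp: ws_def)
  hence ws0: "ws ! 0 = v" using ws(3) n by (cases ws) auto
  have dim: "dim_vec (ws ! i) = n" if "i < n" for i
    using ws(1,3) that by (metis carrier_vecD nth_mem subsetD)
  define r where "r i = sqrt (\<Sum>k<n. (cmod (ws ! i $ k))\<^sup>2)" for i
  have ip: "ws ! i \<bullet>c ws ! i = complex_of_real ((r i)\<^sup>2)" if "i < n" for i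
  proof -
    have "ws ! i \<bullet>c ws ! i = (\<Sum>k<n. complex_of_real ((cmod (ws ! i $ k))\<^sup>2))"
      using dim[OF that] by (simp add: scalar_prod_def atLeast0LessThan complex_norm_square del: of_real_power)
    thus ?thesis by (simp add: r_def sum_nonneg del: of_real_power)
  qed
  \<comment> \<open>Orthogonality in the sense of \<open>corthogonal\<close> includes that no vector is isotropic.\<close>
  have r: "r i \<noteq> 0" if "i < n" for i
    using ip[OF that] corthogonalD[OF ws(2), of i i] that ws(3) by auto
  define W where "W = mat n n (\<lambda>(k, j). ws ! j $ k / complex_of_real (r j))"
  have W: "W \<in> carrier_mat n n" by (simp add: W_def)
  have "mat_adjoint W * W = 1\<^sub>m n"
  proof (rule eq_matI)
    fix i j assume ij: "i < dim_row (1\<^sub>m n :: complex mat)" "j < dim_col (1\<^sub>m n :: complex mat)"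
    have "(mat_adjoint W * W) $$ (i, j) = (ws ! j \<bullet>c ws ! i) / (complex_of_real (r i) * complex_of_real (r j))"
      using ij dim W by (simp add: W_def scalar_prod_def sum_divide_distrib mult.commute)
    thus "(mat_adjoint W * W) $$ (i, j) = 1\<^sub>m n $$ (i, j)"
      using ij ip[of i] r[of i] corthogonalD[OF ws(2), of j i] ws(3) by (auto simp: power2_eq_square)
  qed (use W in auto)
  hence "unitary_mat W" using unitary_matI[OF W] by simp
  moreover have "col W 0 = (1 / complex_of_real (r 0)) \<cdot>\<^sub>v v"
    using n v(1) by (intro eq_vecI) (auto simp: W_def ws0)
  ultimately show ?thesis using that W by blast
qed

lemma exists_eigenvector:
  assumes A: "(A :: complex mat) \<in> carrier_mat n n" and n: "n > 0"
  obtains v k where "eigenvector A v k"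
proof -
  have "\<not> constant (poly (char_poly A))"
    using degree_monic_char_poly[OF A] n by (simp add: constant_degree)
  then obtain k where "poly (char_poly A) k = 0"
    using fundamental_theorem_of_algebra by blast
  thus ?thesis using that eigenvalue_root_char_poly[OF A] unfolding eigenvalue_def by blast
qed

text \<open>Deflation: in an orthonormal basis that starts with an eigenvector, the first column of the
  matrix is \<open>k\<close> times a unit vector, and being Hermitian forces the same for the first row and
  makes \<open>k\<close> real. What remains is a Hermitian block of size one less, to which the induction
  hypothesis applies.\<close>

theorem hermitian_spectral_decomposition:
  assumes "A \<in> carrier_mat n n" "mat_adjoint A = A"
  shows "\<exists>Q (d :: nat \<Rightarrow> real). Q \<in> carrier_mat n n \<and> unitary_mat Q \<and>
    A = spectral_mat n Q (\<lambda>i. complex_of_real (d i))"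
  using assms
proof (induction n arbitrary: A)
  case 0
  thus ?case
    by (intro exI[of _ "1\<^sub>m 0"] exI[of _ "\<lambda>_. 0"]) (auto simp: unitary_mat_def spectral_mat_def)
next
  case (Suc n)
  note A = Suc.prems(1)
  obtain v k where ev: "eigenvector A v k" using exists_eigenvector[OF A] by auto
  hence v: "v \<in> carrier_vec (Suc n)" "v \<noteq> 0\<^sub>v (Suc n)" and Av: "A *\<^sub>v v = k \<cdot>\<^sub>v v"
    using A unfolding eigenvector_def by auto
  obtain W c where W [simp]: "W \<in> carrier_mat (Suc n) (Suc n)" and uW: "unitary_mat W"
    and c: "col W 0 = c \<cdot>\<^sub>v v"
    using exists_unitary_first_column[OF v] by blast
  note WW = unitary_matD[OF uW W]
  define A' where "A' = mat_adjoint W * A * W"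
  have A' [simp]: "A' \<in> carrier_mat (Suc n) (Suc n)" unfolding A'_def
    by (intro mult_carrier_mat[of _ _ "Suc n"] adjoint_carrier W A)
  have herm: "mat_adjoint A' = A'"
    by (simp add: A'_def adjoint_mult[of _ "Suc n" "Suc n" _ "Suc n"] Suc.prems
        square_mult_assoc[where n = "Suc n"] square_mult_carrier[where n = "Suc n"])
  have cW: "col W 0 \<in> carrier_vec (Suc n)" using col_dim[of W 0] carrier_matD[OF W] by simp
  have AW: "A *\<^sub>v col W 0 = k \<cdot>\<^sub>v col W 0"
    unfolding c using v(1) Av
    by (simp add: mult_mat_vec[OF A] smult_smult_assoc mult.commute)
  have col0: "col A' 0 = k \<cdot>\<^sub>v unit_vec (Suc n) 0"
  proof -
    have "A' = mat_adjoint W * (A * W)"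
      by (simp add: A A'_def square_mult_assoc[where n = "Suc n"])
    hence "col A' 0 = mat_adjoint W *\<^sub>v (A *\<^sub>v col W 0)"
      by (simp add: A col_mult2[of _ "Suc n" "Suc n" _ "Suc n"] square_mult_carrier[where n = "Suc n"])
    also have "\<dots> = k \<cdot>\<^sub>v (mat_adjoint W *\<^sub>v col W 0)"
      unfolding AW using cW by (simp add: mult_mat_vec[of _ "Suc n" "Suc n"])
    also have "mat_adjoint W *\<^sub>v col W 0 = col (mat_adjoint W * W) 0"
      by (simp add: col_mult2[of _ "Suc n" "Suc n" _ "Suc n"])
    also have "\<dots> = unit_vec (Suc n) 0" by (simp add: WW)
    finally show ?thesis .
  qed
  have entry0: "A' $$ (i, 0) = (if i = 0 then k else 0)" if "i < Suc n" for i
    using that arg_cong[OF col0, of "\<lambda>x. x $ i"] carrier_matD[OF A'] by (auto simp: unit_vec_def)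
  have sym: "A' $$ (i, j) = cnj (A' $$ (j, i))" if "i < Suc n" "j < Suc n" for i j
    using that arg_cong[OF herm, of "\<lambda>X. X $$ (i, j)"] carrier_matD[OF A'] by simp
  have k: "cnj k = k" using sym[of 0 0] entry0[of 0] by simp
  define A3 where "A3 = mat n n (\<lambda>(i, j). A' $$ (Suc i, Suc j))"
  have A3: "A3 \<in> carrier_mat n n" by (simp add: A3_def)
  have "mat_adjoint A3 = A3"
    by (rule eq_matI) (auto simp: A3_def sym[symmetric])
  from Suc.IH[OF A3 this] obtain Q d where Q: "Q \<in> carrier_mat n n" and uQ: "unitary_mat Q"
    and A3Q: "A3 = spectral_mat n Q (\<lambda>i. complex_of_real (d i))" by blast
  note QQ = unitary_matD[OF uQ Q]
  define P where "P = four_block_mat (1\<^sub>m 1) (0\<^sub>m 1 n) (0\<^sub>m n 1) Q"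
  define d' where "d' i = (case i of 0 \<Rightarrow> Re k | Suc j \<Rightarrow> d j)" for i
  have P: "P \<in> carrier_mat (Suc n) (Suc n)"
    using four_block_carrier_mat[of "1\<^sub>m 1" 1 1 Q n n] Q unfolding P_def by simp
  have adjP: "mat_adjoint P = four_block_mat (1\<^sub>m 1) (0\<^sub>m 1 n) (0\<^sub>m n 1) (mat_adjoint Q)"
    unfolding P_def using Q
    by (subst adjoint_four_block[of _ 1 _ n]) (auto intro!: cong_four_block_mat)
  have uP: "unitary_mat P"
    using P
  proof (rule unitary_matI)
    show "mat_adjoint P * P = 1\<^sub>m (Suc n)"
      unfolding adjP unfolding P_def using Q QQ by (subst mult_block_diag) auto
  qed
  have "A' = four_block_mat (k \<cdot>\<^sub>m 1\<^sub>m 1) (0\<^sub>m 1 n) (0\<^sub>m n 1) A3"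
  proof (rule eq_matI)
    fix i j assume "i < dim_row (four_block_mat (k \<cdot>\<^sub>m 1\<^sub>m 1) (0\<^sub>m 1 n) (0\<^sub>m n 1) A3)"
      "j < dim_col (four_block_mat (k \<cdot>\<^sub>m 1\<^sub>m 1) (0\<^sub>m 1 n) (0\<^sub>m n 1) A3)"
    hence ij: "i < Suc n" "j < Suc n" using A3 by auto
    show "A' $$ (i, j) = four_block_mat (k \<cdot>\<^sub>m 1\<^sub>m 1) (0\<^sub>m 1 n) (0\<^sub>m n 1) A3 $$ (i, j)"
      using ij entry0[of i] entry0[of j] sym[of i j] A3
      by (cases i; cases j) (auto simp: A3_def)
  qed (use A3 carrier_matD[OF A'] in auto)
  also have "\<dots> = spectral_mat (Suc n) P (\<lambda>i. complex_of_real (d' i))"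
  proof -
    have D: "mat_diag (Suc n) (\<lambda>i. complex_of_real (d' i)) =
        four_block_mat (k \<cdot>\<^sub>m 1\<^sub>m 1) (0\<^sub>m 1 n) (0\<^sub>m n 1) (mat_diag n (\<lambda>i. complex_of_real (d i)))"
      using k by (intro eq_matI) (auto simp: mat_diag_def d'_def complex_eq_iff split: nat.splits)
    show ?thesis
      unfolding spectral_mat_def D adjP unfolding P_def A3Q spectral_mat_def using Q
      by (simp add: mult_block_diag[of _ 1 _ _ n] square_mult_carrier[where n = n] del: One_nat_def)
  qed
  finally have A'P: "A' = spectral_mat (Suc n) P (\<lambda>i. complex_of_real (d' i))" .
  have "A = W * A' * mat_adjoint W"
    by (simp add: A right_mult_one_mat[OF A] A'_def WW
        square_mult_assoc[where n = "Suc n"] square_mult_carrier[where n = "Suc n"]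
        mult_cancel_mid[OF _ _ WW(2)])
  also have "\<dots> = spectral_mat (Suc n) (P * mat_adjoint W) (\<lambda>i. complex_of_real (d' i))"
    using spectral_mat_unitary_change[OF P, of "mat_adjoint W"] A'P by simp
  finally have "A = spectral_mat (Suc n) (P * mat_adjoint W) (\<lambda>i. complex_of_real (d' i))" .
  moreover have "P * mat_adjoint W \<in> carrier_mat (Suc n) (Suc n)"
    "unitary_mat (P * mat_adjoint W)"
    using P unitary_mult[OF P uP adjoint_carrier[OF W] unitary_adjoint[OF uW]] by auto
  ultimately show ?case by blast
qed

section \<open>The signs of the eigenvalues of the block matrix\<close>

theorem theorem1:
  fixes n :: nat and \<theta> :: real and A M :: "complex mat"
  assumes "n \<ge> 1"
    and "\<theta> \<noteq> 0"
    and "A \<in> carrier_mat n n"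
    and "M = four_block_mat
               (complex_of_real \<theta> \<cdot>\<^sub>m 1\<^sub>m n) (mat_adjoint A)
               A (- complex_of_real \<theta> \<cdot>\<^sub>m 1\<^sub>m n)"
  shows "invertible_mat (mat_abs M) \<and>
         hermitian_mat (mat_inv (mat_abs M) * M) \<and>
         unitary_mat (mat_inv (mat_abs M) * M) \<and>
         {k. eigenvalue (mat_inv (mat_abs M) * M) k} = {1, -1}"
proof -
  define N where "N = n + n"
  \<comment> \<open>The diagonal of \<open>J = diag(I, -I)\<close>; the diagonal of \<open>M\<close> is \<open>\<theta>\<close> times it.\<close>
  define s :: "nat \<Rightarrow> complex" where "s i = (if i < n then 1 else -1)" for i
  have M: "M \<in> carrier_mat N N"
    using assms(3) unfolding assms(4) N_def by simp
  have Mdiag: "M $$ (i, i) = \<theta> * s i" if "i < N" for i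
    using that assms(3) by (auto simp: assms(4) N_def s_def)
  have "mat_adjoint M = M"
    unfolding assms(4)
    using assms(3) by (subst adjoint_four_block[of _ n _ n]) (auto intro!: cong_four_block_mat)
  then obtain Q and d :: "nat \<Rightarrow> real" where Q: "unitary_mat Q" "Q \<in> carrier_mat N N"
    and MQ: "M = spectral_mat N Q (\<lambda>i. complex_of_real (d i))"
    using hermitian_spectral_decomposition[OF M] by blast
  note QQ = unitary_matD[OF Q]
  have d: "d i \<noteq> 0" if i: "i < N" for i
  proof -
    define J where "J = mat_diag N s"
    define D where "D = mat_diag N (\<lambda>i. complex_of_real (d i))"
    define B where "B = Q * J * mat_adjoint Q"
    note [simp] = Q(2) right_mult_one_mat[of _ N N] QQ
      square_mult_assoc[where n = N] square_mult_carrier[where n = N]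
      mult_cancel_mid[OF _ _ QQ(1)] mult_cancel_mid[OF _ _ QQ(2)]
    have [simp]: "J \<in> carrier_mat N N" "D \<in> carrier_mat N N" and B: "B \<in> carrier_mat N N"
      by (auto simp: J_def D_def B_def)
    \<comment> \<open>Entry \<open>(i, j)\<close> of the left side is \<open>M i j (s i + s j)\<close>: the factor is \<open>0\<close> in the
      off-diagonal blocks, and the other two blocks are diagonal.\<close>
    have anti: "M * J + J * M = (2 * complex_of_real \<theta>) \<cdot>\<^sub>m 1\<^sub>m N"
      unfolding J_def mat_diag_mult_left[OF M] mat_diag_mult_right[OF M]
      using assms(3) by (intro eq_matI) (auto simp: assms(4) N_def s_def)
    have "D * B + B * D = Q * (M * J + J * M) * mat_adjoint Q"
      unfolding MQ
      by (simp add: B_def D_def[symmetric] spectral_mat_def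
          add_mult_distrib_mat[of _ N N _ _ N] mult_add_distrib_mat[of _ N N _ N])
    also have "\<dots> = (2 * complex_of_real \<theta>) \<cdot>\<^sub>m 1\<^sub>m N"
      unfolding anti by (simp add: mult_smult_distrib[of _ N N _ N] mult_smult_assoc_mat[of _ N N _ N])
    finally have "(D * B + B * D) $$ (i, i) = 2 * complex_of_real \<theta>"
      using i by simp
    moreover have "(D * B + B * D) $$ (i, i) = 2 * complex_of_real (d i) * B $$ (i, i)"
      unfolding D_def mat_diag_mult_left[OF B] mat_diag_mult_right[OF B] using i by simp
    ultimately show ?thesis using assms(2) by auto
  qed
  have diag_sum: "\<theta> * Re (s a) = (\<Sum>i<N. d i * (cmod (Q $$ (i, a)))\<^sup>2)" if "a < N" for a
  proof -
    have "complex_of_real (\<theta> * Re (s a)) = M $$ (a, a)"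
      using Mdiag[OF that] by (simp add: s_def)
    also have "\<dots> = complex_of_real (\<Sum>i<N. d i * (cmod (Q $$ (i, a)))\<^sup>2)"
      using spectral_mat_diag_entry[OF Q(2) that] by (simp add: MQ)
    finally show ?thesis using of_real_eq_iff by blast
  qed
  \<comment> \<open>Columns \<open>0\<close> and \<open>n\<close> are the first columns of the two halves, where \<open>s\<close> is \<open>1\<close> and \<open>-1\<close>.\<close>
  have ends: "\<theta> = (\<Sum>i<N. d i * (cmod (Q $$ (i, 0)))\<^sup>2)" "- \<theta> = (\<Sum>i<N. d i * (cmod (Q $$ (i, n)))\<^sup>2)"
    using diag_sum[of 0] diag_sum[of n] assms(1) by (auto simp: s_def N_def)
  have pos: "\<exists>i<N. d i > 0"
  proof (rule ccontr)
    assume "\<not> ?thesis"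
    hence "(\<Sum>i<N. d i * (cmod (Q $$ (i, a)))\<^sup>2) \<le> 0" for a
      by (intro sum_nonpos mult_nonpos_nonneg) auto
    from this[of 0] this[of n] ends assms(2) show False by linarith
  qed
  have neg: "\<exists>i<N. d i < 0"
  proof (rule ccontr)
    assume "\<not> ?thesis"
    hence "(\<Sum>i<N. d i * (cmod (Q $$ (i, a)))\<^sup>2) \<ge> 0" for a
      by (intro sum_nonneg mult_nonneg_nonneg) auto
    from this[of 0] this[of n] ends assms(2) show False by linarith
  qed
  define S where "S = spectral_mat N Q (\<lambda>i. complex_of_real (sgn (d i)))"
  have S: "S \<in> carrier_mat N N" using Q by (simp add: S_def)
  have S_adj: "mat_adjoint S = S" using Q by (simp add: S_def adjoint_spectral_mat)
  have "S * S = spectral_mat N Q (\<lambda>_. 1)"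
    unfolding S_def spectral_mat_mult[OF Q] using d
    by (intro spectral_mat_cong) (auto simp: sgn_real_def)
  hence "S * S = 1\<^sub>m N" using Q by (simp add: spectral_mat_one)
  hence "unitary_mat S" using unitary_matI[OF S] S_adj by simp
  moreover have "hermitian_mat S" using S S_adj by (simp add: hermitian_mat_def)
  moreover have "{k. eigenvalue S k} = {1, -1}"
  proof -
    have "(\<lambda>i. complex_of_real (sgn (d i))) ` {..<N} = {1, -1}"
    proof
      show "(\<lambda>i. complex_of_real (sgn (d i))) ` {..<N} \<subseteq> {1, -1}"
        using d by (auto simp: sgn_real_def)
      show "{1, -1} \<subseteq> (\<lambda>i. complex_of_real (sgn (d i))) ` {..<N}"
        using pos neg by (force simp: image_iff)
    qed
    thus ?thesis unfolding S_def eigenvalue_spectral_mat[OF Q] .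
  qed
  ultimately show ?thesis
    using polar_factor_spectral_mat[OF Q d MQ] by (simp add: S_def)
qed

end
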